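(* Let $f:\mathbb{R}^n\to\mathbb{R}$ be a function of class $C^1$ whose gradient is Lipschitz continuous with constant $L>0$ and which is $\mu$-strongly convex, with $\mu>0$. For every $x_0\in\mathbb{R}^n$, consider the solution $x(\cdot)$ of the Cauchy problem $\ddot x+\nabla f(x)=0$, $x(0)=x_0$, $\dot x(0)=0$, and let $t\mapsto E_K(t)=\frac12|\dot x(t)|^2$ be the kinetic energy function of the solution. Let $t_a$ be the stopping time $$t_a=\inf\{t:\ t\dot E_K(t)-E_K(t)<0\}.$$ Then the following estimates hold: $$t_a>\frac{\sqrt\mu}{8L}\qquad\text{and}\qquad t_a\le\mathcal{T}_R:=32\,\frac{L}{\mu\sqrt\mu}.$$
   Context: $|\cdot|$ is the Euclidean norm on $\mathbb{R}^n$. A function $f$ is $\mu$-strongly convex ($\mu>0$) if $x\mapsto f(x)-\frac12\mu|x|^2$ is convex. The solution $x(\cdot)$ is considered on $[0,+\infty)$, and the infimum defining $t_a$ is over times $t$ in this interval.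
   Formalization: The upper bound on t_a is stated only for x_0 with nonzero gradient of f at x_0; if x_0 is the minimizer, the solution is constant, the set defining t_a is empty, t_a is +infinity and the upper bound fails. The lower bound holds for every x_0. *)

theory Defs
  imports "HOL-Analysis.Analysis" "HOL-Library.Extended_Real"
begin

definition strongly_convex :: "real \<Rightarrow> ('a::real_inner \<Rightarrow> real) \<Rightarrow> bool" where
  "strongly_convex \<mu> f \<longleftrightarrow>
     \<mu> > 0 \<and> convex_on UNIV (\<lambda>x. f x - 1 / 2 * \<mu> * (norm x)\<^sup>2)"

(* Curves are functions on all of real of which only the restriction to [0, \<infinity>) matters:
   derivatives are taken within {0..}, hence one-sided at t = 0. *)

definition velocity :: "(real \<Rightarrow> 'a::real_normed_vector) \<Rightarrow> real \<Rightarrow> 'a" where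
  "velocity x t = vector_derivative x (at t within {0..})"

(* x solves x'' + g(x) = 0, x(0) = x0, x'(0) = 0 on [0, \<infinity>). The first derivative condition
   says that velocity x really is the derivative of x (vector_derivative is total). *)
definition conservative_solution ::
    "('a::real_normed_vector \<Rightarrow> 'a) \<Rightarrow> 'a \<Rightarrow> (real \<Rightarrow> 'a) \<Rightarrow> bool" where
  "conservative_solution g x0 x \<longleftrightarrow>
     (\<forall>t\<ge>0. (x has_vector_derivative velocity x t) (at t within {0..})) \<and>
     (\<forall>t\<ge>0. \<exists>a. (velocity x has_vector_derivative a) (at t within {0..}) \<and> a + g (x t) = 0) \<and>
     x 0 = x0 \<and> velocity x 0 = 0"

definition kinetic_energy :: "(real \<Rightarrow> 'a::real_normed_vector) \<Rightarrow> real \<Rightarrow> real" where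
  "kinetic_energy x t = 1 / 2 * (norm (velocity x t))\<^sup>2"

(* Extended-real valued, so that the infimum over the empty set is \<infinity>. *)
definition stopping_time :: "(real \<Rightarrow> 'a::real_normed_vector) \<Rightarrow> ereal" where
  "stopping_time x =
     Inf (ereal ` {t. t \<ge> 0 \<and>
       t * vector_derivative (kinetic_energy x) (at t within {0..}) - kinetic_energy x t < 0})"

end

theory Submission
  imports Defs
begin

text \<open>
  Put \<open>A = |\<nabla>f(x\<^sub>0)|\<close> and \<open>T\<^sub>0 = 1 / (4 \<surd>L)\<close>. On \<open>[0, T\<^sub>0]\<close> the acceleration stays within \<open>A / 15\<close>
  of its initial value, so the motion is almost uniformly accelerated: \<open>t E\<^sub>K'(t) \<ge> E\<^sub>K(t)\<close>
  throughout, and \<open>E\<^sub>K(T\<^sub>0)\<close> is at least a fixed multiple of \<open>T\<^sub>0\<^sup>2 A\<^sup>2\<close>. Since \<open>\<mu> \<le> L\<close>, this gives the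
  lower bound. As long as \<open>t E\<^sub>K' \<ge> E\<^sub>K\<close>, the quotient \<open>E\<^sub>K(t) / t\<close> is nondecreasing, so \<open>E\<^sub>K\<close> grows at
  least linearly with slope \<open>E\<^sub>K(T\<^sub>0) / T\<^sub>0\<close>. But energy conservation and strong convexity
  give \<open>E\<^sub>K(t) = f(x\<^sub>0) - f(x(t)) \<le> A\<^sup>2 / (2 \<mu>)\<close>, which bounds the time this can last.
\<close>

section \<open>Consequences of strong convexity\<close>

text \<open>The convex function \<open>f - \<mu>/2 |.|^2\<close>, restricted to the line through
  \<open>y\<close> and \<open>z\<close>, lies above its tangent at \<open>y\<close>. The quadratic
  terms recombine into \<open>\<mu>/2 |z - y|^2\<close>.\<close>

lemma strongly_convex_ge_tangent:
  fixes f :: "'a::real_inner \<Rightarrow> real"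
  assumes conv: "strongly_convex \<mu> f" and der: "GDERIV f y :> g"
  shows "f z \<ge> f y + inner g (z - y) + \<mu> / 2 * (norm (z - y))\<^sup>2"
proof -
  define h where "h = (\<lambda>w. f w - 1 / 2 * \<mu> * (norm w)\<^sup>2)"
  define k where "k = (\<lambda>s. h (y + s *\<^sub>R (z - y)))"
  have h: "convex_on UNIV h"
    using conv by (simp add: strongly_convex_def h_def)
  have "convex_on UNIV k"
  proof (rule convex_onI)
    fix t a b :: real
    assume t: "0 < t" "t < 1"
    have "y + ((1 - t) *\<^sub>R a + t *\<^sub>R b) *\<^sub>R (z - y)
      = (1 - t) *\<^sub>R (y + a *\<^sub>R (z - y)) + t *\<^sub>R (y + b *\<^sub>R (z - y))"
      by (simp add: algebra_simps)
    then show "k ((1 - t) *\<^sub>R a + t *\<^sub>R b) \<le> (1 - t) * k a + t * k b"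
      unfolding k_def using convex_onD[OF h] t by (metis UNIV_I less_eq_real_def)
  qed simp
  moreover have "(k has_real_derivative inner (g - \<mu> *\<^sub>R y) (z - y)) (at 0)"
  proof -
    have f: "(f has_derivative (\<lambda>h. inner h g)) (at (y + 0 *\<^sub>R (z - y)))"
      using der by (simp add: gderiv_def)
    have "((\<lambda>s. y + s *\<^sub>R (z - y)) has_derivative (\<lambda>s. s *\<^sub>R (z - y))) (at (0::real))"
      by (auto intro!: derivative_eq_intros)
    from has_derivative_compose[OF this f]
    have "((\<lambda>s. f (y + s *\<^sub>R (z - y))) has_real_derivative inner g (z - y)) (at 0)"
      by (simp add: has_field_derivative_def inner_commute mult.commute[of _ "inner g _"])
    moreover have "((\<lambda>s. 1 / 2 * \<mu> * (norm (y + s *\<^sub>R (z - y)))\<^sup>2)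
      has_real_derivative \<mu> * inner y (z - y)) (at 0)"
      unfolding power2_norm_eq_inner inner_add inner_scaleR_left inner_scaleR_right
      by (auto intro!: derivative_eq_intros simp: inner_commute)
    ultimately have "(k has_real_derivative inner g (z - y) - \<mu> * inner y (z - y)) (at 0)"
      unfolding k_def h_def by (rule DERIV_diff)
    then show ?thesis
      by (simp add: inner_diff_left)
  qed
  ultimately have "k 1 - k 0 \<ge> inner (g - \<mu> *\<^sub>R y) (z - y) * (1 - 0)"
    by (intro convex_on_imp_above_tangent[of UNIV]) auto
  then show ?thesis
    unfolding k_def h_def power2_norm_eq_inner
    by (simp add: inner_diff inner_commute algebra_simps)
qed

text \<open>Completing the square minimises the quadratic lower bound over all \<open>z\<close>.
  This Polyak-Lojasiewicz inequality caps the potential energy that the motion can release.\<close>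

lemma strongly_convex_ge:
  fixes f :: "'a::real_inner \<Rightarrow> real"
  assumes conv: "strongly_convex \<mu> f" and der: "GDERIV f y :> g"
  shows "f z \<ge> f y - (norm g)\<^sup>2 / (2 * \<mu>)"
proof -
  have mu: "\<mu> > 0"
    using conv by (simp add: strongly_convex_def)
  have "0 \<le> (norm (g + \<mu> *\<^sub>R (z - y)))\<^sup>2 / (2 * \<mu>)"
    using mu by simp
  also have "\<dots> = (norm g)\<^sup>2 / (2 * \<mu>) + inner g (z - y) + \<mu> / 2 * (norm (z - y))\<^sup>2"
    unfolding power2_norm_eq_inner inner_add_left inner_add_right inner_scaleR_left
      inner_scaleR_right inner_commute[of "z - y" g]
    using mu by (simp add: field_simps)
  finally show ?thesis
    using strongly_convex_ge_tangent[OF conv der, of z] by linarith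
qed

text \<open>Adding the tangent inequalities at \<open>y\<close> and at \<open>z\<close> makes
  \<open>g\<close> strongly monotone with constant \<open>\<mu>\<close>; Cauchy-Schwarz bounds the
  same inner product by \<open>L |z - y|^2\<close>.\<close>

lemma strong_convexity_le_lipschitz:
  fixes f :: "'a::real_inner \<Rightarrow> real"
  assumes conv: "strongly_convex \<mu> f" and der: "\<And>y. GDERIV f y :> g y"
    and lip: "L-lipschitz_on UNIV g" and "y \<noteq> (z :: 'a)"
  shows "\<mu> \<le> L"
proof -
  have "\<mu> * (norm (z - y))\<^sup>2 \<le> inner (g z - g y) (z - y)"
    using strongly_convex_ge_tangent[OF conv der, of y z]
      strongly_convex_ge_tangent[OF conv der, of z y]
    by (simp add: inner_diff norm_minus_commute algebra_simps)
  also have "\<dots> \<le> norm (g z - g y) * norm (z - y)"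
    by (rule norm_cauchy_schwarz)
  also have "\<dots> \<le> L * norm (z - y) * norm (z - y)"
    using lipschitz_on_normD[OF lip] by (intro mult_right_mono) auto
  finally show ?thesis
    using \<open>y \<noteq> z\<close> by (simp add: power2_eq_square)
qed

section \<open>Calculus with one-sided derivatives\<close>

lemma norm_increment_le:
  fixes w :: "real \<Rightarrow> 'a::real_normed_vector"
  assumes "0 \<le> t"
    and der: "\<And>s. 0 \<le> s \<Longrightarrow> s \<le> t \<Longrightarrow> (w has_vector_derivative w' s) (at s within {0..})"
    and bound: "\<And>s. 0 \<le> s \<Longrightarrow> s \<le> t \<Longrightarrow> norm (w' s) \<le> B"
  shows "norm (w t - w 0) \<le> B * t"
proof -
  have "norm (w t - w 0) \<le> B * norm (t - 0)"
  proof (rule differentiable_bound)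
    fix s assume "s \<in> {0..t}"
    then show "(w has_derivative (\<lambda>h. h *\<^sub>R w' s)) (at s within {0..t})"
      using der[of s] by (auto simp: has_vector_derivative_def intro: has_derivative_subset)
    show "onorm (\<lambda>h. h *\<^sub>R w' s) \<le> B"
      using bound[of s] \<open>s \<in> {0..t}\<close>
      by (auto intro!: onorm_le simp: onorm_scaleR_left onorm_id)
  qed (use \<open>0 \<le> t\<close> in auto)
  then show ?thesis
    using \<open>0 \<le> t\<close> by simp
qed

text \<open>Nontriviality of this filter makes derivatives within \<open>{0..}\<close> unique, so
  that \<open>vector_derivative\<close> returns the computed value even at
  \<open>t = 0\<close>.\<close>

lemma at_within_atLeast_neq_bot:
  fixes t :: real
  assumes "0 \<le> t"
  shows "at t within {0..} \<noteq> bot"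
proof -
  have "at t within {t..t + 1} \<le> at t within {0..}"
    using assms by (intro at_le) auto
  moreover have "at t within {t..t + 1} \<noteq> bot"
    by (simp add: trivial_limit_within islimpt_Icc)
  ultimately show ?thesis
    using bot.extremum_uniqueI by metis
qed

section \<open>Energy along the motion\<close>

locale gradient_motion =
  fixes f :: "'a::real_inner \<Rightarrow> real" and g :: "'a \<Rightarrow> 'a" and L \<mu> :: real
    and x0 :: 'a and x :: "real \<Rightarrow> 'a"
  assumes gradient: "\<And>y. GDERIV f y :> g y"
    and L_pos: "L > 0"
    and lipschitz: "L-lipschitz_on UNIV g"
    and convex: "strongly_convex \<mu> f"
    and solution: "conservative_solution g x0 x"
begin

abbreviation "v \<equiv> velocity x"
abbreviation "E \<equiv> kinetic_energy x"

lemma mu_pos: "\<mu> > 0"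
  using convex by (simp add: strongly_convex_def)

lemma initial: "x 0 = x0" "v 0 = 0"
  using solution by (auto simp: conservative_solution_def)

lemma position_deriv: "t \<ge> 0 \<Longrightarrow> (x has_vector_derivative v t) (at t within {0..})"
  using solution by (simp add: conservative_solution_def)

lemma velocity_deriv:
  assumes "t \<ge> 0"
  shows "(v has_vector_derivative - g (x t)) (at t within {0..})"
proof -
  obtain a where "(v has_vector_derivative a) (at t within {0..})" "a + g (x t) = 0"
    using solution assms by (auto simp: conservative_solution_def)
  moreover from this have "a = - g (x t)"
    by (simp add: eq_neg_iff_add_eq_0)
  ultimately show ?thesis
    by simp
qed

lemma kinetic_energy_deriv:
  assumes "t \<ge> 0"
  shows "(E has_real_derivative - inner (v t) (g (x t))) (at t within {0..})"
proof -
  have v: "(v has_derivative (\<lambda>h. h *\<^sub>R - g (x t))) (at t within {0..})"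
    using velocity_deriv[OF assms] by (simp add: has_vector_derivative_def)
  have "((\<lambda>t. 1 / 2 * inner (v t) (v t)) has_derivative
      (\<lambda>h. 1 / 2 * (inner (v t) (h *\<^sub>R - g (x t)) + inner (h *\<^sub>R - g (x t)) (v t))))
    (at t within {0..})"
    by (intro has_derivative_mult_right has_derivative_inner v)
  moreover have "E = (\<lambda>t. 1 / 2 * inner (v t) (v t))"
    by (simp add: fun_eq_iff kinetic_energy_def power2_norm_eq_inner)
  moreover have "(\<lambda>h. 1 / 2 * (inner (v t) (h *\<^sub>R - g (x t)) + inner (h *\<^sub>R - g (x t)) (v t)))
      = (*) (- inner (v t) (g (x t)))"
    by (simp add: fun_eq_iff inner_commute)
  ultimately show ?thesis
    unfolding has_field_derivative_def by simp
qed

lemma vector_derivative_kinetic_energy: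
  assumes "t \<ge> 0"
  shows "vector_derivative E (at t within {0..}) = - inner (v t) (g (x t))"
  using kinetic_energy_deriv[OF assms] at_within_atLeast_neq_bot[OF assms]
  by (intro vector_derivative_within)
    (simp_all add: has_real_derivative_iff_has_vector_derivative)

lemma stopping_time_eq:
  "stopping_time x = Inf (ereal ` {t. t \<ge> 0 \<and> t * (- inner (v t) (g (x t))) < E t})"
  unfolding stopping_time_def
  by (intro arg_cong[where f = Inf] arg_cong[where f = "(`) ereal"] Collect_cong conj_cong refl)
    (simp add: vector_derivative_kinetic_energy)

lemma energy_conservation:
  assumes "t \<ge> 0"
  shows "E t + f (x t) = f x0"
proof -
  have "((\<lambda>t. E t + f (x t)) has_derivative (\<lambda>h. 0)) (at s within {0..})" if "s \<in> {0..}" for s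
  proof -
    have s: "s \<ge> 0"
      using that by simp
    have "((\<lambda>t. f (x t)) has_derivative (\<lambda>h. inner (h *\<^sub>R v s) (g (x s)))) (at s within {0..})"
      using has_derivative_compose[OF position_deriv[OF s, unfolded has_vector_derivative_def]
        gradient[of "x s", unfolded gderiv_def]] .
    from has_derivative_add[OF
        kinetic_energy_deriv[OF s, unfolded has_field_derivative_def] this]
    show ?thesis
      by (simp add: mult.commute)
  qed
  then obtain c where c: "\<And>s. s \<ge> 0 \<Longrightarrow> E s + f (x s) = c"
    using has_derivative_zero_constant[of "{0::real..}" "\<lambda>t. E t + f (x t)"] by auto
  then show ?thesis
    using c[OF assms] c[of 0] by (simp add: initial kinetic_energy_def)
qed

lemma kinetic_energy_le:
  assumes "t \<ge> 0"
  shows "E t \<le> (norm (g x0))\<^sup>2 / (2 * \<mu>)"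
  using energy_conservation[OF assms] strongly_convex_ge[OF convex gradient, of x0 "x t"]
  by linarith

lemma gradient_continuous: "continuous_on {0..} (\<lambda>t. g (x t))"
proof -
  have "continuous_on {0..} x"
    using has_vector_derivative_continuous[OF position_deriv]
    by (auto simp: continuous_on_eq_continuous_within)
  with lipschitz_on_continuous_on[OF lipschitz] show ?thesis
    by (rule continuous_on_compose2) auto
qed

section \<open>Estimates for short times\<close>

text \<open>A bootstrap on the maximal deviation \<open>M\<close> over \<open>[0, T]\<close>: the
  acceleration is at most \<open>A + M\<close>, hence the speed at most \<open>(A + M) T\<close> and
  the displacement at most \<open>(A + M) T^2\<close>. The Lipschitz bound and
  \<open>L T^2 = 1/16\<close> give \<open>M \<le> (A + M) / 16\<close>, that is,
  \<open>M \<le> A / 15\<close>.\<close>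

lemma gradient_deviation:
  assumes "0 \<le> t" "t \<le> 1 / (4 * sqrt L)"
  shows "norm (g (x t) - g x0) \<le> norm (g x0) / 15"
proof -
  define T where "T = 1 / (4 * sqrt L)"
  have T: "T > 0" "L * T\<^sup>2 = 1 / 16"
    using L_pos by (simp_all add: T_def power_divide power_mult_distrib)
  obtain s where s: "0 \<le> s" "s \<le> T"
    and max: "\<And>r. 0 \<le> r \<Longrightarrow> r \<le> T \<Longrightarrow> norm (g (x r) - g x0) \<le> norm (g (x s) - g x0)"
  proof -
    have "continuous_on {0..T} (\<lambda>r. norm (g (x r) - g x0))"
      by (intro continuous_intros continuous_on_subset[OF gradient_continuous]) auto
    from continuous_attains_sup[OF _ _ this] T show thesis
      using that by fastforce
  qed
  define M where "M = norm (g (x s) - g x0)"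
  define A where "A = norm (g x0)"
  have g_le: "norm (g (x r)) \<le> A + M" if "0 \<le> r" "r \<le> T" for r
    using max[OF that] norm_triangle_sub[of "g (x r)" "g x0"] by (simp add: A_def M_def)
  have AM: "A + M \<ge> 0"
    by (simp add: A_def M_def)
  have v_le: "norm (v r) \<le> (A + M) * T" if r: "0 \<le> r" "r \<le> T" for r
  proof -
    have "norm (v r - v 0) \<le> (A + M) * r"
      using r g_le by (intro norm_increment_le[where w' = "\<lambda>s. - g (x s)"] velocity_deriv) auto
    also have "\<dots> \<le> (A + M) * T"
      using r AM by (intro mult_left_mono)
    finally show ?thesis
      by (simp add: initial)
  qed
  have "norm (x s - x 0) \<le> (A + M) * T * s"
    using s v_le by (intro norm_increment_le[where w' = v] position_deriv) auto
  also have "\<dots> \<le> (A + M) * T * T"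
    using s AM T by (intro mult_left_mono) auto
  finally have "L * norm (x s - x0) \<le> L * ((A + M) * T * T)"
    using L_pos by (simp add: initial)
  also have "\<dots> = (A + M) * (L * T\<^sup>2)"
    by (simp add: power2_eq_square)
  finally have "M \<le> (A + M) / 16"
    using lipschitz_on_normD[OF lipschitz, of "x s" x0] T by (simp add: M_def)
  then show ?thesis
    using max[of t] assms by (simp add: A_def M_def T_def)
qed

lemma velocity_deviation:
  assumes "0 \<le> t" "t \<le> 1 / (4 * sqrt L)"
  shows "norm (v t + t *\<^sub>R g x0) \<le> norm (g x0) / 15 * t"
proof -
  have "norm ((v t + t *\<^sub>R g x0) - (v 0 + 0 *\<^sub>R g x0)) \<le> norm (g x0) / 15 * t"
  proof (rule norm_increment_le)
    fix s assume s: "0 \<le> s" "s \<le> t"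
    show "((\<lambda>s. v s + s *\<^sub>R g x0) has_vector_derivative - (g (x s) - g x0)) (at s within {0..})"
      using velocity_deriv[OF s(1)] by (auto intro!: derivative_eq_intros)
    show "norm (- (g (x s) - g x0)) \<le> norm (g x0) / 15"
      using gradient_deviation[of s] s assms by (simp add: norm_minus_commute)
  qed (use assms in auto)
  then show ?thesis
    by (simp add: initial)
qed

text \<open>For constant acceleration \<open>-a\<close> the two sides are \<open>t^2 A^2 / 2\<close>
  and \<open>t^2 A^2\<close>; this gap absorbs the errors \<open>e\<close> of the velocity and
  \<open>d\<close> of the gradient.\<close>

lemma kinetic_energy_le_early:
  assumes "0 \<le> t" "t \<le> 1 / (4 * sqrt L)"
  shows "E t \<le> t * (- inner (v t) (g (x t)))"
proof -
  define a where "a = g x0"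
  define d where "d = g (x t) - g x0"
  define e where "e = v t + t *\<^sub>R g x0"
  define A where "A = norm a"
  have d: "norm d \<le> A / 15" and e: "norm e \<le> A / 15 * t"
    using gradient_deviation[OF assms] velocity_deviation[OF assms]
    by (simp_all add: a_def d_def e_def A_def)
  have v: "v t = e - t *\<^sub>R a" and g: "g (x t) = a + d"
    by (simp_all add: a_def d_def e_def)
  have A: "A \<ge> 0"
    by (simp add: A_def)
  have "norm (v t) \<le> 16 / 15 * (t * A)"
    using norm_triangle_ineq4[of e "t *\<^sub>R a"] e assms by (simp add: v A_def mult.commute)
  then have "(norm (v t))\<^sup>2 \<le> (16 / 15 * (t * A))\<^sup>2"
    by (intro power_mono) simp_all
  \<comment> \<open>The constant is half the square of \<open>16/15\<close>.\<close>
  then have E: "E t \<le> 128 / 225 * (t * A)\<^sup>2"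
    by (simp add: kinetic_energy_def power_mult_distrib power_divide)
  have ea: "inner e a \<le> A / 15 * t * A"
    using e A assms by (intro order_trans[OF norm_cauchy_schwarz] mult_mono) (auto simp: A_def)
  have ed: "inner e d \<le> A / 15 * t * (A / 15)"
    using d e A assms by (intro order_trans[OF norm_cauchy_schwarz] mult_mono) auto
  have "- inner a d \<le> A * (A / 15)"
    using d A by (intro order_trans[OF abs_ge_minus_self] order_trans[OF Cauchy_Schwarz_ineq2]
      mult_mono) (auto simp: A_def)
  then have ad: "t * (- inner a d) \<le> t * (A * (A / 15))"
    using assms by (intro mult_left_mono)
  have "- inner (v t) (g (x t)) = t * A\<^sup>2 + t * inner a d - inner e a - inner e d"
    unfolding v g A_def power2_norm_eq_inner by (simp add: inner_diff_left inner_add_right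
      algebra_simps)
  \<comment> \<open>The constant is \<open>1 - 1/15 - 1/15 - 1/225\<close>, one loss for each error
    term.\<close>
  also have "\<dots> \<ge> 194 / 225 * (t * A\<^sup>2)"
    using ea ed ad by (simp add: power2_eq_square field_simps)
  finally have "t * (194 / 225 * (t * A\<^sup>2)) \<le> t * (- inner (v t) (g (x t)))"
    using assms by (intro mult_left_mono) auto
  moreover have "t * (194 / 225 * (t * A\<^sup>2)) = 194 / 225 * (t * A)\<^sup>2"
    by (simp add: power2_eq_square)
  ultimately show ?thesis
    using E zero_le_power2[of "t * A"] by linarith
qed

lemma kinetic_energy_ge_early:
  assumes "0 \<le> t" "t \<le> 1 / (4 * sqrt L)"
  shows "E t \<ge> 98 / 225 * (t * norm (g x0))\<^sup>2"
proof -
  have "14 / 15 * (t * norm (g x0)) \<le> norm (v t)"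
    using velocity_deviation[OF assms] norm_triangle_ineq4[of "v t + t *\<^sub>R g x0" "v t"] assms
    by (simp add: mult.commute)
  then have "(14 / 15 * (t * norm (g x0)))\<^sup>2 \<le> (norm (v t))\<^sup>2"
    using assms by (intro power_mono) auto
  then show ?thesis
    by (simp add: kinetic_energy_def power_mult_distrib power_divide)
qed

section \<open>The lower bound\<close>

lemma stopping_time_ge: "stopping_time x \<ge> ereal (1 / (4 * sqrt L))"
  unfolding stopping_time_eq
proof (rule Inf_greatest)
  fix u assume "u \<in> ereal ` {t. t \<ge> 0 \<and> t * (- inner (v t) (g (x t))) < E t}"
  then obtain t where "u = ereal t" "t \<ge> 0" "t * (- inner (v t) (g (x t))) < E t"
    by blast
  then show "ereal (1 / (4 * sqrt L)) \<le> u"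
    using kinetic_energy_le_early[of t] by fastforce
qed

text \<open>From a critical point the motion never starts, so the infimum is over the empty set.
  Hence the upper bound can hold only for \<open>g x0 \<noteq> 0\<close>.\<close>

lemma stopping_time_critical:
  assumes "g x0 = 0"
  shows "stopping_time x = \<infinity>"
proof -
  have "E t \<le> 0" if "t \<ge> 0" for t
    using kinetic_energy_le[OF that] assms by simp
  then have "v t = 0" if "t \<ge> 0" for t
    using that by (simp add: kinetic_energy_def)
  then have "{t. t \<ge> 0 \<and> t * (- inner (v t) (g (x t))) < E t} = {}"
    by (auto simp: kinetic_energy_def)
  then show ?thesis
    unfolding stopping_time_eq by (simp only: image_empty Inf_empty top_ereal_def)
qed

lemma stopping_time_gt: "stopping_time x > ereal (sqrt \<mu> / (8 * L))"
proof (cases "g x0 = 0")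
  case True
  then show ?thesis
    by (simp add: stopping_time_critical)
next
  case False
  \<comment> \<open>The comparison of \<open>\<mu>\<close> with \<open>L\<close> requires two
    distinct points; \<open>g x0\<close> and \<open>0\<close> serve.\<close>
  have "sqrt \<mu> \<le> sqrt L"
    using strong_convexity_le_lipschitz[OF convex gradient lipschitz False] by simp
  then have "sqrt \<mu> / (8 * L) \<le> sqrt L / (8 * L)"
    using L_pos by (intro divide_right_mono) auto
  also have "\<dots> = 1 / (8 * sqrt L)"
    using L_pos by (simp add: field_simps)
  \<comment> \<open>The spare factor 2 provides the strict inequality.\<close>
  also have "\<dots> < 1 / (4 * sqrt L)"
    using L_pos by (simp add: divide_simps)
  finally show ?thesis
    using stopping_time_ge by (meson ereal_less_eq(3) less_ereal.simps(1) less_le_trans)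
qed

section \<open>The upper bound\<close>

text \<open>The derivative of \<open>E t / t\<close> is \<open>(t E' - E) / t^2\<close>, which is
  nonnegative under the hypothesis.\<close>

lemma kinetic_energy_linear_growth:
  assumes "0 < a" "a \<le> b"
    and "\<And>t. a \<le> t \<Longrightarrow> t \<le> b \<Longrightarrow> E t \<le> t * (- inner (v t) (g (x t)))"
  shows "E a / a \<le> E b / b"
proof (rule DERIV_nonneg_imp_nondecreasing[OF \<open>a \<le> b\<close>])
  fix t assume t: "a \<le> t" "t \<le> b"
  then have "t > 0"
    using \<open>0 < a\<close> by simp
  then have "at t within {0..} = at t"
    by (intro at_within_interior) simp
  then have "(E has_real_derivative - inner (v t) (g (x t))) (at t)"
    using kinetic_energy_deriv[of t] \<open>t > 0\<close> by simp
  then have "((\<lambda>t. E t / t) has_real_derivative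
      ((- inner (v t) (g (x t))) * t - E t * 1) / (t * t)) (at t)"
    using \<open>t > 0\<close> by (intro DERIV_divide DERIV_ident) auto
  moreover have "((- inner (v t) (g (x t))) * t - E t * 1) / (t * t) \<ge> 0"
    using assms(3)[OF t] by (intro divide_nonneg_nonneg) (auto simp: mult.commute)
  ultimately show "\<exists>y. ((\<lambda>t. E t / t) has_real_derivative y) (at t) \<and> y \<ge> 0"
    by blast
qed

lemma stopping_time_le:
  assumes "g x0 \<noteq> 0"
  shows "stopping_time x \<le> ereal (32 * (L / (\<mu> * sqrt \<mu>)))"
proof -
  define T where "T = 32 * (L / (\<mu> * sqrt \<mu>))"
  define a where "a = 1 / (4 * sqrt L)"
  define A where "A = norm (g x0)"
  have A: "A\<^sup>2 > 0"
    using assms by (simp add: A_def)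
  have mu_le: "\<mu> \<le> L"
    using strong_convexity_le_lipschitz[OF convex gradient lipschitz assms] .
  have a: "a > 0"
    using L_pos by (simp add: a_def)
  \<comment> \<open>In terms of the square roots, \<open>a * T\<close> becomes the rational
    expression \<open>8 q / p^3\<close>.\<close>
  define p where "p = sqrt \<mu>"
  define q where "q = sqrt L"
  have p: "p > 0" "\<mu> = p\<^sup>2" and q: "q > 0" "L = q\<^sup>2" and pq: "p \<le> q"
    using mu_pos L_pos mu_le by (simp_all add: p_def q_def)
  have "a * T = 8 * q / p ^ 3"
    unfolding a_def T_def p_def[symmetric] q_def[symmetric] p(2) q(2)
    using p(1) q(1) by (simp add: field_simps power2_eq_square power3_eq_cube)
  moreover have "8 * q / p ^ 3 \<ge> 8 * p / p ^ 3"
    using p pq by (intro divide_right_mono) auto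
  moreover have "8 * p / p ^ 3 = 8 / \<mu>"
    using p by (simp add: power2_eq_square power3_eq_cube)
  ultimately have aT: "a * T \<ge> 8 / \<mu>"
    by simp
  \<comment> \<open>Comparing \<open>a * a\<close> with \<open>a * T\<close> places the end
    \<open>a\<close> of the early phase before \<open>T\<close>.\<close>
  have "a\<^sup>2 \<le> 1 / \<mu>"
    unfolding a_def using mu_pos mu_le L_pos
    by (simp add: power_divide power_mult_distrib divide_simps)
  also have "\<dots> \<le> 8 / \<mu>"
    using mu_pos by (simp add: divide_simps)
  also note aT
  finally have "a \<le> T"
    using a by (simp add: power2_eq_square)
  have "\<exists>t. 0 \<le> t \<and> t \<le> T \<and> t * (- inner (v t) (g (x t))) < E t"
  proof (rule ccontr)
    assume "\<not> ?thesis"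
    then have "E t \<le> t * (- inner (v t) (g (x t)))" if "a \<le> t" "t \<le> T" for t
      using that a by (meson less_le_trans less_imp_le not_less)
    then have "E a / a \<le> E T / T"
      using a \<open>a \<le> T\<close> by (intro kinetic_energy_linear_growth)
    moreover have "98 / 225 * (a * A)\<^sup>2 / a \<le> E a / a"
      using kinetic_energy_ge_early[of a] a
      by (intro divide_right_mono) (simp_all add: a_def[symmetric] A_def)
    ultimately have "98 / 225 * (a * A)\<^sup>2 / a \<le> E T / T"
      by linarith
    then have "98 / 225 * (a * T) * A\<^sup>2 \<le> E T"
      using a \<open>a \<le> T\<close> by (simp add: field_simps power2_eq_square)
    moreover have "98 / 225 * (8 / \<mu>) * A\<^sup>2 \<le> 98 / 225 * (a * T) * A\<^sup>2"
      using aT by (intro mult_right_mono mult_left_mono) auto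
    moreover have "E T \<le> A\<^sup>2 / (2 * \<mu>)"
      using kinetic_energy_le[of T] a \<open>a \<le> T\<close> by (simp add: A_def)
    \<comment> \<open>Cancelling \<open>A^2 / \<mu>\<close> leaves \<open>784/225 \<le> 1/2\<close>,
      which is false.\<close>
    ultimately have "98 / 225 * (8 / \<mu>) * A\<^sup>2 \<le> A\<^sup>2 / (2 * \<mu>)"
      by linarith
    then show False
      using A mu_pos by (simp add: field_simps)
  qed
  then obtain t where "0 \<le> t" "t \<le> T" "t * (- inner (v t) (g (x t))) < E t"
    by blast
  then have "stopping_time x \<le> ereal t"
    unfolding stopping_time_eq by (intro Inf_lower) auto
  also have "\<dots> \<le> ereal T"
    using \<open>t \<le> T\<close> by simp
  finally show ?thesis
    by (simp add: T_def)
qed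

end

theorem proposition3p3:
  fixes f :: "real ^ 'n \<Rightarrow> real" and gradf :: "real ^ 'n \<Rightarrow> real ^ 'n"
    and L \<mu> :: real and x0 :: "real ^ 'n" and x :: "real \<Rightarrow> real ^ 'n"
  assumes "\<And>y. GDERIV f y :> gradf y"
    and "continuous_on UNIV gradf"
    and "L > 0"
    and "L-lipschitz_on UNIV gradf"
    and "\<mu> > 0"
    and "strongly_convex \<mu> f"
    and "conservative_solution gradf x0 x"
  shows "stopping_time x > ereal (sqrt \<mu> / (8 * L)) \<and>
    (gradf x0 \<noteq> 0 \<longrightarrow> stopping_time x \<le> ereal (32 * (L / (\<mu> * sqrt \<mu>))))"
proof -
  interpret gradient_motion f gradf L \<mu> x0 x
    using assms by unfold_locales
  show ?thesis
    using stopping_time_gt stopping_time_le by blast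
qed

end
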